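(* Let $0<\eta<1/2$, $\epsilon\in(0,1)$, and let $\mathcal U_\eta$, the graph $\mathcal I_\epsilon(V^*,E^*,{\rm wt}_{\rm BS})$ and the vectors $\mathbf V_{v,x}$ be as in the context, with $t=2^{240}+1$. Then there is an absolute constant $C$ such that $$\sum_{e^*\{(v,x),(w,y)\}\in E^*}{\rm wt}_{\rm BS}(e^* )\,\big\|\mathbf V_{v,x}^{\otimes t}-\mathbf V_{w,y}^{\otimes t}\big\|^2\le C(\eta+\epsilon).$$
   Context: Let $N=2^k$ and identify $[N]$ with $\mathbb F_2^k$ with operation $\oplus$. Let $\mathcal U_\eta=(G(V,E),[N],\{\pi_e\},{\rm wt})$ be a Unique Games instance (bijections $\pi_e$ on edges $e\{v,w\}$ encoding $\lambda(v)=\pi_e(\lambda(w))$, weights summing to 1) with, for every vertex $v$, vectors $v_1,\dots,v_N\in\mathbb R^N$ such that: $|V|=2^N/N$ and ${\rm opt}(\mathcal U_\eta)\le(\log|V|)^{-\eta}$; each $\{v_i\}_i$ is an orthonormal basis; $1+\langle u_i,v_j\rangle\ge\langle u_i,w_\ell\rangle+\langle v_j,w_\ell\rangle$ for all vertices $u,v,w$ and $i,j,\ell$; $\langle v_i,w_j\rangle=\langle v_{i\oplus\ell},w_{j\oplus\ell}\rangle$ for all $v,w,i,j,\ell$; and for each edge $e\{v,w\}$ there are $i_0,j_0$ with $\langle v_{i_0},w_{j_0}\rangle\ge1-4\eta$ and $i_0\oplus\ell=\pi_e(j_0\oplus\ell)$ for all $\ell$ (such an instance exists for every such $\eta,N$).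 The graph $\mathcal I_\epsilon$ has vertex set $V^*=\{(v,x):v\in V,x\in\{-1,1\}^N\}$ and, for each $e\{v,w\}\in E$ and $x,y\in\{-1,1\}^N$, an edge $e^*$ between $(v,x)$ and $(w,y)$ of weight ${\rm wt}_{\rm BS}(e^* )={\rm wt}(e)\cdot\Pr[x'=x\wedge y=(x'\mu)\circ\pi_e]$, where $x'$ is uniform in $\{-1,1\}^N$, $\mu\in\{-1,1\}^N$ has independent coordinates equal to $-1$ with probability $\epsilon$, $x'\mu$ is the coordinatewise product and $(z\circ\pi)_j=z_{\pi(j)}$. Define $\mathbf V_{v,x}=\frac1{\sqrt N}\sum_{i\in[N]}x_i v_i^{\otimes 8}$. *)

theory Defs
  imports "HOL-Probability.Probability" "Graph_Theory.Digraph"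
begin

text \<open>
  A Unique Games instance lives on an undirected graph in which loops and parallel edges are
  allowed. Each edge $e\{v,w\}$ is stored once, as an arc with tail $v$ and head $w$; the
  direction only records which way the bijection $\pi_e$ is read, namely
  $\lambda(v) = \pi_e(\lambda(w))$. The label set $[N]$ is \<open>{..<N}\<close>.
\<close>

locale unique_game = fin_digraph G
  for G :: "('v, 'e) pre_digraph" +
  fixes N :: nat
    and \<pi> :: "'e \<Rightarrow> nat \<Rightarrow> nat"
    and wt :: "'e \<Rightarrow> real"
  assumes constraint_bij: "e \<in> arcs G \<Longrightarrow> bij_betw (\<pi> e) {..<N} {..<N}"
    and wt_nonneg: "e \<in> arcs G \<Longrightarrow> 0 \<le> wt e"
    and wt_sum: "(\<Sum>e\<in>arcs G. wt e) = 1"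

definition ug_value ::
  "('v, 'e) pre_digraph \<Rightarrow> ('e \<Rightarrow> nat \<Rightarrow> nat) \<Rightarrow> ('e \<Rightarrow> real) \<Rightarrow> ('v \<Rightarrow> nat) \<Rightarrow> real" where
  "ug_value G \<pi> wt lab =
     (\<Sum>e\<in>arcs G. if lab (tail G e) = \<pi> e (lab (head G e)) then wt e else 0)"

definition ug_opt ::
  "('v, 'e) pre_digraph \<Rightarrow> nat \<Rightarrow> ('e \<Rightarrow> nat \<Rightarrow> nat) \<Rightarrow> ('e \<Rightarrow> real) \<Rightarrow> real" where
  "ug_opt G N \<pi> wt = Max (ug_value G \<pi> wt ` (verts G \<rightarrow>\<^sub>E {..<N}))"

text \<open>
  Vectors with real coordinates indexed by a finite set \<open>I\<close> are functions of which only the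
  values on \<open>I\<close> matter; their Euclidean norm is \<^const>\<open>L2_set\<close>.
\<close>

definition inner_on :: "'i set \<Rightarrow> ('i \<Rightarrow> real) \<Rightarrow> ('i \<Rightarrow> real) \<Rightarrow> real" where
  "inner_on I u v = (\<Sum>i\<in>I. u i * v i)"

definition orthonormal_basis :: "nat \<Rightarrow> (nat \<Rightarrow> nat \<Rightarrow> real) \<Rightarrow> bool" where
  "orthonormal_basis N b \<longleftrightarrow>
     (\<forall>i<N. \<forall>j<N. inner_on {..<N} (b i) (b j) = (if i = j then 1 else 0)) \<and>
     (\<forall>u. \<exists>c. \<forall>a<N. u a = (\<Sum>i<N. c i * b i a))"

text \<open>
  The coordinates of the \<open>t\<close>-th tensor power of a vector over \<open>I\<close> are indexed by \<open>t\<close>-tuples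
  from \<open>I\<close>, represented as lists.
\<close>

definition tensor_index :: "nat \<Rightarrow> 'i set \<Rightarrow> 'i list set" where
  "tensor_index t I = {is. set is \<subseteq> I \<and> length is = t}"

definition tensor_power :: "nat \<Rightarrow> ('i \<Rightarrow> real) \<Rightarrow> 'i list \<Rightarrow> real" where
  "tensor_power t u is = (\<Prod>j<t. u (is ! j))"

text \<open>
  The instance $\mathcal U_\eta$ together with its vectors: \<open>b v i\<close> is $v_i$. With $N = 2^k$, a
  label is identified with the vector of its \<open>k\<close> binary digits, so that $\oplus$ is bitwise
  \<^const>\<open>xor\<close>. The bound on the optimum uses the natural logarithm; as $\eta > 0$, it follows from
  the same bound with logarithms to base 2.
\<close>

lemma xor_less_power_2:
  fixes i j k :: nat
  assumes "i < 2 ^ k" "j < 2 ^ k"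
  shows "xor i j < 2 ^ k"
  using assms by (simp flip: take_bit_nat_eq_self_iff)

locale ug_vector_instance = unique_game G N \<pi> wt
  for \<eta> :: real and k N :: nat
    and G :: "('v, 'e) pre_digraph" and \<pi> :: "'e \<Rightarrow> nat \<Rightarrow> nat" and wt :: "'e \<Rightarrow> real"
    and b :: "'v \<Rightarrow> nat \<Rightarrow> nat \<Rightarrow> real" +
  assumes N_eq: "N = 2 ^ k"
    and card_verts: "real (card (verts G)) = 2 ^ N / real N"
    and opt_le: "ug_opt G N \<pi> wt \<le> ln (real (card (verts G))) powr (- \<eta>)"
    and basis: "v \<in> verts G \<Longrightarrow> orthonormal_basis N (b v)"
    and triangle:
      "\<lbrakk>u \<in> verts G; v \<in> verts G; w \<in> verts G; i < N; j < N; l < N\<rbrakk> \<Longrightarrow>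
        1 + inner_on {..<N} (b u i) (b v j)
          \<ge> inner_on {..<N} (b u i) (b w l) + inner_on {..<N} (b v j) (b w l)"
    and shift:
      "\<lbrakk>v \<in> verts G; w \<in> verts G; i < N; j < N; l < N\<rbrakk> \<Longrightarrow>
        inner_on {..<N} (b v i) (b w j) = inner_on {..<N} (b v (xor i l)) (b w (xor j l))"
    and matching:
      "e \<in> arcs G \<Longrightarrow>
        \<exists>i<N. \<exists>j<N. inner_on {..<N} (b (tail G e) i) (b (head G e) j) \<ge> 1 - 4 * \<eta> \<and>
          (\<forall>l<N. xor i l = \<pi> e (xor j l))"

abbreviation cube :: "nat \<Rightarrow> (nat \<Rightarrow> real) set" where
  "cube N \<equiv> {..<N} \<rightarrow>\<^sub>E {-1, 1}"

definition noise :: "real \<Rightarrow> nat \<Rightarrow> (nat \<Rightarrow> real) pmf" where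
  "noise \<epsilon> N =
     Pi_pmf {..<N} undefined (\<lambda>_. map_pmf (\<lambda>flip. if flip then -1 else 1) (bernoulli_pmf \<epsilon>))"

text \<open>
  The graph $\mathcal I_\epsilon$: its edge $e^*$ between $(v,x)$ and $(w,y)$ that comes from the
  edge $e\{v,w\}$ is \<open>(e, x, y)\<close>.
\<close>

definition bs_graph ::
  "('v, 'e) pre_digraph \<Rightarrow> nat \<Rightarrow>
     ('v \<times> (nat \<Rightarrow> real), 'e \<times> (nat \<Rightarrow> real) \<times> (nat \<Rightarrow> real)) pre_digraph" where
  "bs_graph G N =
     \<lparr>verts = verts G \<times> cube N,
      arcs = arcs G \<times> cube N \<times> cube N,
      tail = (\<lambda>(e, x, y). (tail G e, x)),
      head = (\<lambda>(e, x, y). (head G e, y))\<rparr>"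

definition bs_weight ::
  "real \<Rightarrow> nat \<Rightarrow> ('e \<Rightarrow> nat \<Rightarrow> nat) \<Rightarrow> ('e \<Rightarrow> real) \<Rightarrow>
     'e \<times> (nat \<Rightarrow> real) \<times> (nat \<Rightarrow> real) \<Rightarrow> real" where
  "bs_weight \<epsilon> N \<pi> wt = (\<lambda>(e, x, y).
     wt e * measure_pmf.prob (pair_pmf (pmf_of_set (cube N)) (noise \<epsilon> N))
       {(x', \<mu>). x' = x \<and> y = (\<lambda>j\<in>{..<N}. x' (\<pi> e j) * \<mu> (\<pi> e j))})"

definition bs_vector ::
  "nat \<Rightarrow> ('v \<Rightarrow> nat \<Rightarrow> nat \<Rightarrow> real) \<Rightarrow> 'v \<times> (nat \<Rightarrow> real) \<Rightarrow> nat list \<Rightarrow> real" where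
  "bs_vector N b = (\<lambda>(v, x) is.
     1 / sqrt (real N) * (\<Sum>i<N. x i * tensor_power 8 (b v i) is))"

definition tensor_dist ::
  "nat \<Rightarrow> 'i set \<Rightarrow> ('i \<Rightarrow> real) \<Rightarrow> ('i \<Rightarrow> real) \<Rightarrow> real" where
  "tensor_dist t I u v =
     L2_set (\<lambda>is. tensor_power t u is - tensor_power t v is) (tensor_index t I)"

end

theory Submission
  imports Defs
begin

text \<open>
  The vectors $\mathbf V_{v,x}$ are unit vectors, so the squared distance of their \<open>t\<close>-th tensor
  powers is $2 - 2\rho^t \le 2t(1-\rho)$ with
  $\rho = \frac1N \sum_{i,j} x_i y_j \langle v_i,w_j\rangle^8$. By shift invariance all matched
  pairs have the same inner product $r \ge 1-4\eta$. As $\sum_i \langle v_i,w_j\rangle^2 = 1$, the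
  unmatched pairs contribute at most $1-r^2 \le 8\eta$ to $\rho$ in absolute value, while the matched
  ones contribute $r^8(1-2\epsilon) \ge 1-32\eta-2\epsilon$ on average over \<open>x\<close> and the noise.
\<close>

section \<open>Tensor powers: inner products and distances\<close>

lemma finite_tensor_index [simp]: "finite I \<Longrightarrow> finite (tensor_index t I)"
  unfolding tensor_index_def by (rule finite_lists_length_eq)

lemma tensor_index_Suc:
  "tensor_index (Suc t) I = (\<lambda>(i, is). i # is) ` (I \<times> tensor_index t I)"
proof (rule set_eqI)
  show "is \<in> tensor_index (Suc t) I \<longleftrightarrow> is \<in> (\<lambda>(i, is). i # is) ` (I \<times> tensor_index t I)" for "is"
    by (cases "is") (auto simp: tensor_index_def image_iff)
qed

lemma tensor_power_Cons: "tensor_power (Suc t) u (i # is) = u i * tensor_power t u is"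
  unfolding tensor_power_def prod.lessThan_Suc_shift by simp

text \<open>Splitting off the first index of a tuple makes the sum over tuples factor into a sum
  over \<open>I\<close> and a sum over shorter tuples.\<close>

lemma inner_on_tensor_power:
  assumes "finite I"
  shows "inner_on (tensor_index t I) (tensor_power t u) (tensor_power t v) = inner_on I u v ^ t"
proof (induction t)
  case 0
  then show ?case by (simp add: inner_on_def tensor_index_def tensor_power_def cong: conj_cong)
next
  case (Suc t)
  have "inner_on (tensor_index (Suc t) I) (tensor_power (Suc t) u) (tensor_power (Suc t) v)
      = (\<Sum>(i, is)\<in>I \<times> tensor_index t I. u i * v i * (tensor_power t u is * tensor_power t v is))"
    unfolding inner_on_def tensor_index_Suc
    by (subst sum.reindex) (auto simp: inj_on_def tensor_power_Cons algebra_simps intro!: sum.cong)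
  also have "\<dots> = inner_on I u v * inner_on (tensor_index t I) (tensor_power t u) (tensor_power t v)"
    by (simp add: inner_on_def sum_product sum.cartesian_product)
  finally show ?case using Suc by simp
qed

lemma tensor_dist_sq:
  assumes "finite I"
  shows "(tensor_dist t I u v)\<^sup>2 = inner_on I u u ^ t + inner_on I v v ^ t - 2 * inner_on I u v ^ t"
proof -
  have "(tensor_dist t I u v)\<^sup>2
      = (\<Sum>is\<in>tensor_index t I. (tensor_power t u is - tensor_power t v is)\<^sup>2)"
    unfolding tensor_dist_def L2_set_def by (simp add: sum_nonneg)
  also have "\<dots> = inner_on (tensor_index t I) (tensor_power t u) (tensor_power t u)
      + inner_on (tensor_index t I) (tensor_power t v) (tensor_power t v)
      - 2 * inner_on (tensor_index t I) (tensor_power t u) (tensor_power t v)"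
    by (simp add: inner_on_def power2_eq_square algebra_simps sum.distrib sum_subtractf
        sum_distrib_left)
  finally show ?thesis by (simp add: inner_on_tensor_power assms)
qed

text \<open>Bernoulli's inequality covers nonnegative \<rho>. For negative \<rho> and
  \<open>t \<ge> 2\<close> the left side is at most 2 because \<rho> has absolute value at most 1,
  while the right side is at least \<open>t\<close>; for \<open>t = 1\<close> both sides
  agree.\<close>

lemma one_minus_power_le:
  fixes \<rho> :: real
  assumes "-1 \<le> \<rho>" "odd t"
  shows "1 - \<rho> ^ t \<le> t * (1 - \<rho>)"
proof (cases "0 \<le> \<rho>")
  case True
  then show ?thesis using Bernoulli_inequality[of "\<rho> - 1" t] by (simp add: algebra_simps)
next
  case neg: False
  consider "t = 1" | "t \<ge> 2" using \<open>odd t\<close> by (cases t) (auto simp: Suc_le_eq)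
  then show ?thesis
  proof cases
    case 2
    have "\<bar>\<rho> ^ t\<bar> \<le> 1" unfolding power_abs using assms neg by (intro power_le_one) auto
    then have "1 - \<rho> ^ t \<le> 2 * 1" by linarith
    also have "\<dots> \<le> t * (1 - \<rho>)" using 2 neg by (intro mult_mono) auto
    finally show ?thesis .
  qed simp
qed

lemma tensor_dist_sq_le:
  assumes "finite I" "inner_on I u u = 1" "inner_on I v v = 1" "odd t"
  shows "(tensor_dist t I u v)\<^sup>2 \<le> 2 * real t * (1 - inner_on I u v)"
proof -
  \<comment> \<open>Only one side of Cauchy-Schwarz is called for, and for unit vectors it follows
    from the squared norm of \<open>u + v\<close> being nonnegative.\<close>
  have "0 \<le> (\<Sum>i\<in>I. (u i + v i)\<^sup>2)" by (simp add: sum_nonneg)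
  also have "\<dots> = inner_on I u u + inner_on I v v + 2 * inner_on I u v"
    by (simp add: inner_on_def power2_eq_square algebra_simps sum.distrib sum_distrib_left)
  finally have "-1 \<le> inner_on I u v" using assms by simp
  from one_minus_power_le[OF this \<open>odd t\<close>] show ?thesis
    using assms by (simp add: tensor_dist_sq)
qed

section \<open>Orthonormal bases and inner products of the vectors \<open>bs_vector\<close>\<close>

lemma parseval:
  assumes "orthonormal_basis N b"
  shows "(\<Sum>i<N. (inner_on {..<N} (b i) u)\<^sup>2) = inner_on {..<N} u u"
proof -
  have orth: "inner_on {..<N} (b i) (b j) = (if i = j then 1 else 0)" if "i < N" "j < N" for i j
    using assms that by (simp add: orthonormal_basis_def)
  obtain c where c: "\<And>a. a < N \<Longrightarrow> u a = (\<Sum>i<N. c i * b i a)"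
    using assms unfolding orthonormal_basis_def by metis
  \<comment> \<open>The expansion is stated for every \<open>z\<close> because it serves twice:
    \<open>z = b j\<close> identifies \<open>c j\<close> as the inner product with
    \<open>b j\<close>, and \<open>z = u\<close> then gives the squared norm.\<close>
  have expand: "inner_on {..<N} z u = (\<Sum>i<N. c i * inner_on {..<N} z (b i))" for z
  proof -
    have "inner_on {..<N} z u = (\<Sum>a<N. \<Sum>i<N. c i * (z a * b i a))"
      unfolding inner_on_def by (intro sum.cong refl) (simp add: c sum_distrib_left mult_ac)
    also have "\<dots> = (\<Sum>i<N. c i * inner_on {..<N} z (b i))"
      by (subst sum.swap) (simp add: inner_on_def sum_distrib_left)
    finally show ?thesis .
  qed
  have coeff: "inner_on {..<N} (b j) u = c j" if "j < N" for j
    using that by (simp add: expand orth if_distrib cong: if_cong)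
  have "inner_on {..<N} u u = (\<Sum>i<N. c i * inner_on {..<N} (b i) u)"
    using expand[of u] by (simp add: inner_on_def mult.commute)
  then show ?thesis by (simp add: coeff power2_eq_square)
qed

text \<open>Eighth tensor powers turn inner products into their eighth powers. The outer sum runs
  over \<open>j\<close> so that, for one fixed \<open>b w j\<close>, the sum over \<open>i\<close>
  can be compared with Parseval's identity.\<close>

lemma inner_on_bs_vector:
  "inner_on (tensor_index 8 {..<N}) (bs_vector N b (v, x)) (bs_vector N b (w, y))
    = (\<Sum>j<N. \<Sum>i<N. x i * y j * inner_on {..<N} (b v i) (b w j) ^ 8) / N"
proof -
  have prod: "bs_vector N b (v, x) is * bs_vector N b (w, y) is
     = (\<Sum>j<N. \<Sum>i<N. x i * y j * (tensor_power 8 (b v i) is * tensor_power 8 (b w j) is) / N)"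
    for "is"
  proof -
    have "bs_vector N b (v, x) is * bs_vector N b (w, y) is
       = (\<Sum>j<N. y j * tensor_power 8 (b w j) is) * (\<Sum>i<N. x i * tensor_power 8 (b v i) is) / N"
      by (simp add: bs_vector_def)
    also have "\<dots> = (\<Sum>j<N. \<Sum>i<N.
        (y j * tensor_power 8 (b w j) is) * (x i * tensor_power 8 (b v i) is) / N)"
      by (simp only: sum_product sum_divide_distrib)
    finally show ?thesis by (simp only: mult_ac)
  qed
  have "inner_on (tensor_index 8 {..<N}) (bs_vector N b (v, x)) (bs_vector N b (w, y))
     = (\<Sum>is\<in>tensor_index 8 {..<N}. \<Sum>j<N. \<Sum>i<N.
         x i * y j * (tensor_power 8 (b v i) is * tensor_power 8 (b w j) is) / N)"
    by (simp add: inner_on_def prod)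
  also have "\<dots> = (\<Sum>j<N. \<Sum>i<N. \<Sum>is\<in>tensor_index 8 {..<N}.
         x i * y j * (tensor_power 8 (b v i) is * tensor_power 8 (b w j) is) / N)"
    by (subst sum.swap, intro sum.cong refl, rule sum.swap)
  also have "\<dots> = (\<Sum>j<N. \<Sum>i<N. x i * y j *
      inner_on (tensor_index 8 {..<N}) (tensor_power 8 (b v i)) (tensor_power 8 (b w j)) / N)"
    by (simp add: inner_on_def sum_distrib_left sum_divide_distrib)
  finally show ?thesis by (simp add: inner_on_tensor_power sum_divide_distrib)
qed

lemma cube_sq: "x \<in> cube N \<Longrightarrow> i < N \<Longrightarrow> x i * x i = 1"
  by (drule PiE_mem[of _ _ _ i]) auto

lemma cube_abs: "x \<in> cube N \<Longrightarrow> i < N \<Longrightarrow> \<bar>x i\<bar> = 1"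
  by (drule PiE_mem[of _ _ _ i]) auto

text \<open>By orthogonality only the diagonal terms survive, and each is the square of a sign; the
  factor \<open>1 / sqrt N\<close> normalises their sum.\<close>

lemma inner_on_bs_vector_self:
  assumes "orthonormal_basis N (b v)" "x \<in> cube N" "0 < N"
  shows "inner_on (tensor_index 8 {..<N}) (bs_vector N b (v, x)) (bs_vector N b (v, x)) = 1"
proof -
  have "(\<Sum>i<N. x i * x j * inner_on {..<N} (b v i) (b v j) ^ 8) = 1" if "j < N" for j
  proof -
    have "(\<Sum>i<N. x i * x j * inner_on {..<N} (b v i) (b v j) ^ 8)
       = (\<Sum>i<N. if i = j then x j * x j else 0)"
      using assms(1) that by (intro sum.cong) (auto simp: orthonormal_basis_def)
    then show ?thesis using that assms by (simp add: cube_sq)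
  qed
  then show ?thesis using \<open>0 < N\<close> by (simp add: inner_on_bs_vector)
qed

text \<open>For a fixed \<open>j\<close>, the partner \<open>i = p j\<close> contributes exactly
  \<open>r ^ 8 * x (p j) * y j\<close>. Parseval leaves total squared mass
  \<open>1 - r\<^sup>2\<close> for all other \<open>i\<close>, and this also bounds their eighth
  powers. Averaging over \<open>j\<close> gives the claim.\<close>

lemma inner_on_bs_vector_ge:
  assumes ov: "orthonormal_basis N (b v)" and ow: "orthonormal_basis N (b w)"
    and bij: "bij_betw p {..<N} {..<N}"
    and r: "\<And>j. j < N \<Longrightarrow> inner_on {..<N} (b v (p j)) (b w j) = r"
    and x: "x \<in> cube N" and y: "y \<in> cube N" and "0 < N"
  shows "r ^ 8 * ((\<Sum>j<N. x (p j) * y j) / N) - (1 - r\<^sup>2)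
    \<le> inner_on (tensor_index 8 {..<N}) (bs_vector N b (v, x)) (bs_vector N b (w, y))"
proof -
  have row: "r ^ 8 * (x (p j) * y j) - (1 - r\<^sup>2)
      \<le> (\<Sum>i<N. x i * y j * inner_on {..<N} (b v i) (b w j) ^ 8)" if j: "j < N" for j
  proof -
    define s where "s i = inner_on {..<N} (b v i) (b w j)" for i
    have pj: "p j < N" using bij j by (auto simp: bij_betw_def)
    have total: "(\<Sum>i<N. (s i)\<^sup>2) = 1"
      using parseval[OF ov] ow j by (simp add: s_def orthonormal_basis_def)
    have le1: "(s i)\<^sup>2 \<le> 1" if "i < N" for i
      using total member_le_sum[of i "{..<N}" "\<lambda>i. (s i)\<^sup>2"] that by simp
    \<comment> \<open>Since \<open>(s i)\<^sup>2 \<le> 1\<close>, the eighth power is at most the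
      square, whatever the two signs are.\<close>
    have "- (s i)\<^sup>2 \<le> x i * y j * s i ^ 8" if "i < N" for i
    proof -
      have "\<bar>x i * y j * s i ^ 8\<bar> = ((s i)\<^sup>2) ^ 4"
        using cube_abs[OF x that] cube_abs[OF y j] by (simp add: abs_mult power_abs flip: power_mult)
      also have "\<dots> \<le> ((s i)\<^sup>2) ^ 1"
        using le1[OF that] by (intro power_decreasing) auto
      finally show ?thesis by simp
    qed
    then have "- (\<Sum>i\<in>{..<N} - {p j}. (s i)\<^sup>2) \<le> (\<Sum>i\<in>{..<N} - {p j}. x i * y j * s i ^ 8)"
      unfolding sum_negf[symmetric] by (intro sum_mono) auto
    moreover have "(\<Sum>i\<in>{..<N} - {p j}. (s i)\<^sup>2) = 1 - (s (p j))\<^sup>2"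
      using total pj by (simp add: sum_diff1)
    moreover have "s (p j) = r" using r j by (simp add: s_def)
    ultimately show ?thesis
      using pj by (simp add: sum.remove[of "{..<N}" "p j"] s_def mult_ac)
  qed
  have "r ^ 8 * (\<Sum>j<N. x (p j) * y j) - N * (1 - r\<^sup>2)
      = (\<Sum>j<N. r ^ 8 * (x (p j) * y j) - (1 - r\<^sup>2))"
    by (simp add: sum_subtractf sum_distrib_left)
  also have "\<dots> \<le> (\<Sum>j<N. \<Sum>i<N. x i * y j * inner_on {..<N} (b v i) (b w j) ^ 8)"
    using row by (intro sum_mono) auto
  finally have "(r ^ 8 * (\<Sum>j<N. x (p j) * y j) - N * (1 - r\<^sup>2)) / N
      \<le> (\<Sum>j<N. \<Sum>i<N. x i * y j * inner_on {..<N} (b v i) (b w j) ^ 8) / N"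
    by (rule divide_right_mono) simp
  then show ?thesis using \<open>0 < N\<close> by (simp only: inner_on_bs_vector diff_divide_distrib) simp
qed

section \<open>The common inner product of matched labels\<close>

lemma (in ug_vector_instance) matched_inner:
  assumes e: "e \<in> arcs G"
  obtains r where "1 - 4 * \<eta> \<le> r"
    and "\<And>j. j < N \<Longrightarrow> inner_on {..<N} (b (tail G e) (\<pi> e j)) (b (head G e) j) = r"
proof -
  obtain i0 j0 where ij: "i0 < N" "j0 < N"
    and ge: "1 - 4 * \<eta> \<le> inner_on {..<N} (b (tail G e) i0) (b (head G e) j0)"
    and m: "\<And>l. l < N \<Longrightarrow> xor i0 l = \<pi> e (xor j0 l)"
    using matching[OF e] by blast
  have "inner_on {..<N} (b (tail G e) (\<pi> e j)) (b (head G e) j)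
      = inner_on {..<N} (b (tail G e) i0) (b (head G e) j0)" if "j < N" for j
  proof -
    \<comment> \<open>Shifting both labels by \<open>l = xor j0 j\<close> carries the pair
      \<open>i0\<close>, \<open>j0\<close> to the pair \<open>\<pi> e j\<close>, \<open>j\<close>.
      That \<open>N\<close> is a power of 2 keeps \<open>l\<close> in the label range.\<close>
    have l: "xor j0 j < N" using ij that xor_less_power_2[of j0 k j] by (simp add: N_eq)
    have "xor j0 (xor j0 j) = j" by (simp flip: xor.assoc)
    then show ?thesis
      using shift[OF tail_in_verts[OF e] head_in_verts[OF e] ij l] m[OF l] by simp
  qed
  with ge show thesis by (rule that)
qed

section \<open>The random pair of cube points on one edge\<close>

lemma finite_cube: "finite (cube N)"
  by (simp add: finite_PiE)

lemma cube_nonempty: "cube N \<noteq> {}"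
  by (simp add: PiE_eq_empty_iff)

text \<open>The default value \<open>undefined\<close> of the product distribution is the value that
  extensional functions take outside \<open>{..<N}\<close>, so samples are genuine members of
  \<open>cube N\<close>.\<close>

lemma set_pmf_noise_subset: "set_pmf (noise \<epsilon> N) \<subseteq> cube N"
  unfolding noise_def
  by (rule order_trans[OF set_Pi_pmf_subset']) (auto simp: PiE_dflt_def PiE_iff extensional_def split: if_splits)

lemma expectation_noise:
  assumes "0 \<le> \<epsilon>" "\<epsilon> \<le> 1" "i < N"
  shows "measure_pmf.expectation (noise \<epsilon> N) (\<lambda>\<mu>. \<mu> i) = 1 - 2 * \<epsilon>"
proof -
  have "measure_pmf.expectation (noise \<epsilon> N) (\<lambda>\<mu>. \<mu> i)
      = measure_pmf.expectation (map_pmf (\<lambda>\<mu>. \<mu> i) (noise \<epsilon> N)) (\<lambda>z. z)"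
    by simp
  also have "map_pmf (\<lambda>\<mu>. \<mu> i) (noise \<epsilon> N)
      = map_pmf (\<lambda>flip. if flip then -1 else 1) (bernoulli_pmf \<epsilon>)"
    unfolding noise_def using assms by (simp add: Pi_pmf_component)
  finally show ?thesis using assms by (simp add: algebra_simps)
qed

text \<open>The joint law of \<open>x\<close> and \<open>y\<close> on an edge with bijection
  \<open>p\<close>. It lets the weighted sum over cube points be read as an expectation.\<close>

definition noisy_pair :: "real \<Rightarrow> nat \<Rightarrow> (nat \<Rightarrow> nat) \<Rightarrow> ((nat \<Rightarrow> real) \<times> (nat \<Rightarrow> real)) pmf" where
  "noisy_pair \<epsilon> N p = map_pmf (\<lambda>(x, \<mu>). (x, \<lambda>j\<in>{..<N}. x (p j) * \<mu> (p j)))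
     (pair_pmf (pmf_of_set (cube N)) (noise \<epsilon> N))"

text \<open>The event in \<open>bs_weight\<close> is the preimage of the point \<open>(x, y)\<close>
  under the map that defines \<open>noisy_pair\<close>.\<close>

lemma bs_weight_eq: "bs_weight \<epsilon> N \<pi> wt (e, x, y) = wt e * pmf (noisy_pair \<epsilon> N (\<pi> e)) (x, y)"
  unfolding bs_weight_def noisy_pair_def pmf_map
  by (auto intro!: arg_cong2[where f = measure] arg_cong2[where f = "(*)"])

text \<open>This finite support gives integrability of every function and turns expectations into
  sums over \<open>cube N \<times> cube N\<close>.\<close>

lemma set_pmf_noisy_pair_subset:
  assumes "bij_betw p {..<N} {..<N}"
  shows "set_pmf (noisy_pair \<epsilon> N p) \<subseteq> cube N \<times> cube N"
proof -
  have step: "(\<lambda>j\<in>{..<N}. x (p j) * \<mu> (p j)) \<in> cube N" if "x \<in> cube N" "\<mu> \<in> cube N" for x \<mu>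
  proof
    fix j assume "j \<in> {..<N}"
    then have "p j < N" using assms by (auto simp: bij_betw_def)
    then have "x (p j) \<in> {-1, 1}" "\<mu> (p j) \<in> {-1, 1}" using that by (auto simp: PiE_iff)
    then show "(\<lambda>j\<in>{..<N}. x (p j) * \<mu> (p j)) j \<in> {-1, 1}" using \<open>j \<in> {..<N}\<close> by auto
  qed auto
  show ?thesis
    unfolding noisy_pair_def set_map_pmf set_pair_pmf set_pmf_of_set[OF cube_nonempty finite_cube]
  proof (rule image_subsetI)
    fix z assume "z \<in> cube N \<times> set_pmf (noise \<epsilon> N)"
    then have "fst z \<in> cube N" "snd z \<in> set_pmf (noise \<epsilon> N)" by (simp_all only: mem_Times_iff)
    from this(1) subsetD[OF set_pmf_noise_subset this(2)]
    show "(case z of (x, \<mu>) \<Rightarrow> (x, \<lambda>j\<in>{..<N}. x (p j) * \<mu> (p j))) \<in> cube N \<times> cube N"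
      by (simp only: case_prod_unfold mem_Times_iff fst_conv snd_conv step)
  qed
qed

lemma expectation_noisy_pair:
  assumes bij: "bij_betw p {..<N} {..<N}" and \<epsilon>: "0 \<le> \<epsilon>" "\<epsilon> \<le> 1" and j: "j < N"
  shows "measure_pmf.expectation (noisy_pair \<epsilon> N p) (\<lambda>(x, y). x (p j) * y j) = 1 - 2 * \<epsilon>"
proof -
  let ?M = "pair_pmf (pmf_of_set (cube N)) (noise \<epsilon> N)"
  have pj: "p j < N" using bij j by (auto simp: bij_betw_def)
  have "measure_pmf.expectation (noisy_pair \<epsilon> N p) (\<lambda>(x, y). x (p j) * y j)
      = measure_pmf.expectation ?M (\<lambda>(x, \<mu>). x (p j) * x (p j) * \<mu> (p j))"
    using j by (simp add: noisy_pair_def case_prod_unfold mult.assoc)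
  \<comment> \<open>The sign \<open>x (p j)\<close> enters squared, so the uniform point drops out
    and one noise coordinate remains.\<close>
  also have "\<dots> = measure_pmf.expectation ?M (\<lambda>z. snd z (p j))"
    using pj by (intro integral_cong_AE)
      (auto simp: AE_measure_pmf_iff set_pmf_of_set[OF cube_nonempty finite_cube] cube_sq)
  also have "\<dots> = measure_pmf.expectation (map_pmf snd ?M) (\<lambda>\<mu>. \<mu> (p j))"
    by simp
  also have "\<dots> = 1 - 2 * \<epsilon>"
    using expectation_noise[OF \<epsilon> pj] by (simp only: map_snd_pair_pmf)
  finally show ?thesis .
qed

lemma expectation_noisy_pair_average:
  assumes bij: "bij_betw p {..<N} {..<N}" and \<epsilon>: "0 \<le> \<epsilon>" "\<epsilon> \<le> 1" and "0 < N"
  shows "measure_pmf.expectation (noisy_pair \<epsilon> N p) (\<lambda>(x, y). (\<Sum>j<N. x (p j) * y j) / N)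
    = 1 - 2 * \<epsilon>"
proof -
  have fin: "finite (set_pmf (noisy_pair \<epsilon> N p))"
    using set_pmf_noisy_pair_subset[OF bij] by (rule finite_subset) (simp add: finite_cube)
  have "measure_pmf.expectation (noisy_pair \<epsilon> N p) (\<lambda>z. \<Sum>j<N. fst z (p j) * snd z j)
      = (\<Sum>j<N. measure_pmf.expectation (noisy_pair \<epsilon> N p) (\<lambda>z. fst z (p j) * snd z j))"
    by (intro Bochner_Integration.integral_sum integrable_measure_pmf_finite fin)
  also have "\<dots> = N * (1 - 2 * \<epsilon>)"
    using expectation_noisy_pair[OF bij \<epsilon>] by (simp add: case_prod_unfold)
  finally show ?thesis using \<open>0 < N\<close> by (simp add: case_prod_unfold)
qed

section \<open>Expected squared distance on one edge and on the whole graph\<close>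

context ug_vector_instance
begin

lemma N_pos: "0 < N"
  by (simp add: N_eq)

lemma expected_tensor_dist_sq_le:
  assumes \<eta>: "0 < \<eta>" and \<epsilon>: "0 < \<epsilon>" "\<epsilon> < 1" and t: "odd t" and e: "e \<in> arcs G"
  shows "measure_pmf.expectation (noisy_pair \<epsilon> N (\<pi> e)) (\<lambda>(x, y).
      (tensor_dist t (tensor_index 8 {..<N})
        (bs_vector N b (tail G e, x)) (bs_vector N b (head G e, y)))\<^sup>2) \<le> 80 * real t * (\<eta> + \<epsilon>)"
proof -
  let ?P = "noisy_pair \<epsilon> N (\<pi> e)"
  let ?D = "\<lambda>x y. (tensor_dist t (tensor_index 8 {..<N})
        (bs_vector N b (tail G e, x)) (bs_vector N b (head G e, y)))\<^sup>2"
  let ?m = "\<lambda>x y. (\<Sum>j<N. x (\<pi> e j) * y j) / N"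
  note bij = constraint_bij[OF e]
  note ov = basis[OF tail_in_verts[OF e]] and ow = basis[OF head_in_verts[OF e]]
  obtain r where r: "1 - 4 * \<eta> \<le> r"
    and inner: "\<And>j. j < N \<Longrightarrow> inner_on {..<N} (b (tail G e) (\<pi> e j)) (b (head G e) j) = r"
    using matched_inner[OF e] by blast
  \<comment> \<open>The square of \<open>r\<close> is one term of Parseval's sum for the unit vector
    of label 0 at the head.\<close>
  have r1: "r\<^sup>2 \<le> 1"
  proof -
    have "\<pi> e 0 < N" using bij N_pos by (auto simp: bij_betw_def)
    then have "r\<^sup>2 \<le> (\<Sum>i<N. (inner_on {..<N} (b (tail G e) i) (b (head G e) 0))\<^sup>2)"
      using member_le_sum[of "\<pi> e 0" "{..<N}"
          "\<lambda>i. (inner_on {..<N} (b (tail G e) i) (b (head G e) 0))\<^sup>2"] inner[OF N_pos] by simp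
    also have "\<dots> = 1"
      using parseval[OF ov] ow N_pos by (simp add: orthonormal_basis_def)
    finally show ?thesis .
  qed
  \<comment> \<open>Squaring \<open>1 - 4 * \<eta> \<le> r\<close> is legitimate only when the left
    side is nonnegative; otherwise \<open>8 * \<eta>\<close> exceeds 2 and the bound is
    trivial.\<close>
  have r2: "1 - r\<^sup>2 \<le> 8 * \<eta>"
  proof (cases "4 * \<eta> \<le> 1")
    case True
    then have "(1 - 4 * \<eta>)\<^sup>2 \<le> r\<^sup>2" using r by (intro power_mono) auto
    then show ?thesis by (simp add: power2_eq_square algebra_simps) (smt (verit) \<eta> mult_nonneg_nonneg)
  next
    case False
    then show ?thesis by (smt (verit) zero_le_power2)
  qed
  \<comment> \<open>Bernoulli is applied to the fourth power of \<open>r\<^sup>2\<close>, so the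
    sign of \<open>r\<close> does not matter; the constant is 32 = 4 * 8.\<close>
  have r8: "1 - 32 * \<eta> \<le> r ^ 8" "r ^ 8 \<le> 1"
  proof -
    have "1 + real 4 * (r\<^sup>2 - 1) \<le> (1 + (r\<^sup>2 - 1)) ^ 4"
      by (rule Bernoulli_inequality) simp
    moreover have "(r\<^sup>2) ^ 4 = r ^ 8" by (simp flip: power_mult)
    moreover have "(r\<^sup>2) ^ 4 \<le> 1" by (rule power_le_one) (use r1 in auto)
    ultimately show "1 - 32 * \<eta> \<le> r ^ 8" "r ^ 8 \<le> 1" using r2 by simp_all
  qed
  \<comment> \<open>The right side is affine in the average \<open>?m x y\<close>, so its
    expectation follows from that of \<open>?m\<close>.\<close>
  have bound: "?D x y \<le> 2 * real t * (1 + 8 * \<eta> - r ^ 8 * ?m x y)" if "x \<in> cube N" "y \<in> cube N" for x y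
  proof -
    have "?D x y \<le> 2 * real t * (1 - inner_on (tensor_index 8 {..<N})
        (bs_vector N b (tail G e, x)) (bs_vector N b (head G e, y)))"
      using ov ow that N_pos t by (intro tensor_dist_sq_le inner_on_bs_vector_self) auto
    also have "\<dots> \<le> 2 * real t * (1 + 8 * \<eta> - r ^ 8 * ?m x y)"
      using inner_on_bs_vector_ge[OF ov ow bij inner that N_pos] r2
      by (intro mult_left_mono) auto
    finally show ?thesis .
  qed
  have fin: "finite (set_pmf ?P)"
    using set_pmf_noisy_pair_subset[OF bij] by (rule finite_subset) (simp add: finite_cube)
  note int = integrable_measure_pmf_finite[OF fin]
  have "measure_pmf.expectation ?P (\<lambda>z. ?D (fst z) (snd z))
      \<le> measure_pmf.expectation ?P (\<lambda>z. 2 * real t * (1 + 8 * \<eta> - r ^ 8 * ?m (fst z) (snd z)))"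
    using bound set_pmf_noisy_pair_subset[OF bij]
    by (intro integral_mono_AE int) (force simp: AE_measure_pmf_iff)
  also have "\<dots> = 2 * real t * (1 + 8 * \<eta> - r ^ 8 * measure_pmf.expectation ?P (\<lambda>z. ?m (fst z) (snd z)))"
    by (subst integral_mult_right_zero, subst Bochner_Integration.integral_diff)
      (use int in \<open>simp_all only: integral_mult_right_zero, simp_all\<close>)
  also have "\<dots> = 2 * real t * (1 + 8 * \<eta> - r ^ 8 * (1 - 2 * \<epsilon>))"
    using expectation_noisy_pair_average[OF bij _ _ N_pos, of \<epsilon>] \<epsilon>
    by (simp add: case_prod_unfold)
  \<comment> \<open>Here 40 = 8 + 32: unmatched pairs cost \<open>8 * \<eta>\<close>, the loss in
    \<open>r ^ 8\<close> costs \<open>32 * \<eta>\<close>, and the noise costs at most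
    \<open>2 * \<epsilon>\<close> because \<open>r ^ 8 \<le> 1\<close>.\<close>
  also have "\<dots> \<le> 2 * real t * (40 * (\<eta> + \<epsilon>))"
  proof (intro mult_left_mono)
    have "r ^ 8 * (2 * \<epsilon>) \<le> 1 * (2 * \<epsilon>)" using r8 \<epsilon> by (intro mult_right_mono) auto
    then show "1 + 8 * \<eta> - r ^ 8 * (1 - 2 * \<epsilon>) \<le> 40 * (\<eta> + \<epsilon>)"
      unfolding right_diff_distrib mult_1_right distrib_left using r8 \<epsilon> by linarith
  qed simp
  also have "\<dots> = 80 * real t * (\<eta> + \<epsilon>)" by simp
  finally show ?thesis unfolding case_prod_unfold .
qed

text \<open>Grouping the arcs by the edge they come from gives the \<open>wt\<close>-average of the
  expectations on single edges. All of these obey the same bound, and the weights sum to 1.\<close>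

lemma weighted_tensor_dist_sq_le:
  assumes \<eta>: "0 < \<eta>" and \<epsilon>: "0 < \<epsilon>" "\<epsilon> < 1" and t: "odd t"
  shows "(\<Sum>e\<in>arcs (bs_graph G N). bs_weight \<epsilon> N \<pi> wt e *
      (tensor_dist t (tensor_index 8 {..<N})
        (bs_vector N b (tail (bs_graph G N) e)) (bs_vector N b (head (bs_graph G N) e)))\<^sup>2)
    \<le> 80 * real t * (\<eta> + \<epsilon>)"
proof -
  let ?D = "\<lambda>e (x, y). (tensor_dist t (tensor_index 8 {..<N})
        (bs_vector N b (tail G e, x)) (bs_vector N b (head G e, y)))\<^sup>2"
  have "(\<Sum>e\<in>arcs (bs_graph G N). bs_weight \<epsilon> N \<pi> wt e *
      (tensor_dist t (tensor_index 8 {..<N})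
        (bs_vector N b (tail (bs_graph G N) e)) (bs_vector N b (head (bs_graph G N) e)))\<^sup>2)
    = (\<Sum>(e, z)\<in>arcs G \<times> cube N \<times> cube N. wt e * (?D e z * pmf (noisy_pair \<epsilon> N (\<pi> e)) z))"
  proof (rule sum.cong)
    show "bs_weight \<epsilon> N \<pi> wt z * (tensor_dist t (tensor_index 8 {..<N})
        (bs_vector N b (tail (bs_graph G N) z)) (bs_vector N b (head (bs_graph G N) z)))\<^sup>2
      = (case z of (e, z) \<Rightarrow> wt e * (?D e z * pmf (noisy_pair \<epsilon> N (\<pi> e)) z))" for z
      by (cases z) (simp add: bs_graph_def bs_weight_eq)
  qed (simp add: bs_graph_def)
  also have "\<dots> = (\<Sum>e\<in>arcs G. wt e * (\<Sum>z\<in>cube N \<times> cube N. ?D e z * pmf (noisy_pair \<epsilon> N (\<pi> e)) z))"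
    unfolding sum_distrib_left by (rule sum.cartesian_product[symmetric])
  also have "\<dots> = (\<Sum>e\<in>arcs G. wt e * measure_pmf.expectation (noisy_pair \<epsilon> N (\<pi> e)) (?D e))"
  proof (intro sum.cong refl arg_cong2[where f = "(*)"])
    fix e assume "e \<in> arcs G"
    note sub = set_pmf_noisy_pair_subset[OF constraint_bij[OF this], of \<epsilon>]
    show "(\<Sum>z\<in>cube N \<times> cube N. ?D e z * pmf (noisy_pair \<epsilon> N (\<pi> e)) z)
        = measure_pmf.expectation (noisy_pair \<epsilon> N (\<pi> e)) (?D e)"
      by (rule integral_measure_pmf_real[symmetric])
        (simp add: finite_cube, rule subsetD[OF sub])
  qed
  also have "\<dots> \<le> (\<Sum>e\<in>arcs G. wt e * (80 * real t * (\<eta> + \<epsilon>)))"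
    using expected_tensor_dist_sq_le[OF \<eta> \<epsilon> t] wt_nonneg by (intro sum_mono mult_left_mono) auto
  also have "\<dots> = 80 * real t * (\<eta> + \<epsilon>)"
    using wt_sum by (simp flip: sum_distrib_right)
  finally show ?thesis .
qed

end

theorem theorem5p3:
  "\<exists>C::real. \<forall>(\<eta>::real) (\<epsilon>::real) (k::nat) (N::nat) (G::('v, 'e) pre_digraph)
      (\<pi>::'e \<Rightarrow> nat \<Rightarrow> nat) (wt::'e \<Rightarrow> real) (b::'v \<Rightarrow> nat \<Rightarrow> nat \<Rightarrow> real).
    0 < \<eta> \<longrightarrow> \<eta> < 1 / 2 \<longrightarrow> 0 < \<epsilon> \<longrightarrow> \<epsilon> < 1 \<longrightarrow>
    ug_vector_instance \<eta> k N G \<pi> wt b \<longrightarrow>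
    (\<Sum>e\<in>arcs (bs_graph G N). bs_weight \<epsilon> N \<pi> wt e *
      (tensor_dist (2 ^ 240 + 1) (tensor_index 8 {..<N})
        (bs_vector N b (tail (bs_graph G N) e)) (bs_vector N b (head (bs_graph G N) e)))\<^sup>2)
    \<le> C * (\<eta> + \<epsilon>)"
proof -
  have "odd (2 ^ 240 + 1 :: nat)" by simp
  \<comment> \<open>The factor \<open>80 * real t\<close> is absolute because \<open>t\<close> is a
    fixed number; it does not depend on \<open>N\<close>, the graph or the vectors.\<close>
  from ug_vector_instance.weighted_tensor_dist_sq_le[OF _ _ _ _ this] show ?thesis
    by (intro exI[of _ "80 * real (2 ^ 240 + 1)"] allI impI)
qed

end
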